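(* For every $n\ge 3$, the Vénéreau polynomial $v_n=y+x^n(xz+y(yu+z^2))$ is an $x$-variable of the polynomial ring $\mathbb{C}[x,y,z,u]$. More precisely, the map $$\alpha_n:\mathbb{A}^4_{\mathbb{C}}\to\mathbb{A}^4_{\mathbb{C}},\qquad (x,y,z,u)\longmapsto\left(x,v_n,\zeta^{(n)},\theta^{(n)}\right),$$ is an $x$-automorphism of the ring $\mathbb{C}[x,y,z,u]$ (that is, it defines a $\mathbb{C}[x]$-algebra automorphism), where $$\zeta^{(n)}=-z+x^{n-3}t\,(v_n\eta+x^2w),\qquad \theta^{(n)}=u-x^{n-3}t\left(xw^2+\eta\,(\zeta^{(n)}-z+x^{n-1}tw)\right),$$ with $w=z^2+yu$, $t=xz+yw$, and $\eta=x^2u-2xzw-yw^2$.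
   Context: A polynomial $v\in\mathbb{C}[x,y,z,u]$ is an $x$-variable if it is a variable of the $\mathbb{C}[x]$-algebra $\mathbb{C}[x][y,z,u]$, i.e. there exist $g,h$ with $\mathbb{C}[x][y,z,u]=\mathbb{C}[x][v,g,h]$. Note that $v_n=y+x^nt$. *)

theory Defs
  imports Complex_Main "HOL-Library.Poly_Mapping"
begin

text \<open>
  The ring \<open>\<complex>[x,y,z,u]\<close> is the monoid algebra over \<open>\<complex>\<close> of the finitely supported exponent
  vectors \<open>indet \<Rightarrow>\<^sub>0 nat\<close>, with the convolution product of \<^theory>\<open>HOL-Library.Poly_Mapping\<close>.
\<close>

datatype indet = IX | IY | IZ | IU

type_synonym poly4 = "(indet \<Rightarrow>\<^sub>0 nat) \<Rightarrow>\<^sub>0 complex"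

definition const :: "complex \<Rightarrow> poly4" where
  "const c = Poly_Mapping.single 0 c"

definition var :: "indet \<Rightarrow> poly4" where
  "var i = Poly_Mapping.single (Poly_Mapping.single i 1) 1"

abbreviation px :: poly4 where "px \<equiv> var IX"
abbreviation py :: poly4 where "py \<equiv> var IY"
abbreviation pz :: poly4 where "pz \<equiv> var IZ"
abbreviation pu :: poly4 where "pu \<equiv> var IU"

text \<open>The subring \<open>\<complex>[x]\<close>: polynomials all of whose monomials involve \<open>x\<close> only.\<close>

definition Cx :: "poly4 set" where
  "Cx = {p. \<forall>m\<in>Poly_Mapping.keys p. Poly_Mapping.keys m \<subseteq> {IX}}"

inductive_set subring_gen :: "'a::comm_ring_1 set \<Rightarrow> 'a set" for G where
  incl: "a \<in> G \<Longrightarrow> a \<in> subring_gen G"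
| one: "1 \<in> subring_gen G"
| diff: "a \<in> subring_gen G \<Longrightarrow> b \<in> subring_gen G \<Longrightarrow> a - b \<in> subring_gen G"
| mult: "a \<in> subring_gen G \<Longrightarrow> b \<in> subring_gen G \<Longrightarrow> a * b \<in> subring_gen G"

text \<open>\<open>v\<close> is an \<open>x\<close>-variable if \<open>\<complex>[x][y,z,u] = \<complex>[x][v,g,h]\<close> for some \<open>g\<close>, \<open>h\<close>.\<close>

definition x_variable :: "poly4 \<Rightarrow> bool" where
  "x_variable v \<longleftrightarrow> (\<exists>g h. subring_gen (Cx \<union> {v, g, h}) = UNIV)"

text \<open>Automorphisms of a commutative ring, viewed as an algebra over its subring \<open>K\<close>.\<close>

definition algebra_automorphism :: "'a::comm_ring_1 set \<Rightarrow> ('a \<Rightarrow> 'a) \<Rightarrow> bool" where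
  "algebra_automorphism K \<phi> \<longleftrightarrow>
     bij \<phi> \<and> \<phi> 1 = 1 \<and>
     (\<forall>p q. \<phi> (p + q) = \<phi> p + \<phi> q) \<and>
     (\<forall>p q. \<phi> (p * q) = \<phi> p * \<phi> q) \<and>
     (\<forall>c\<in>K. \<phi> c = c)"

text \<open>
  A morphism \<open>\<bbbA>\<^sup>4 \<rightarrow> \<bbbA>\<^sup>4\<close> is given by its four coordinate polynomials \<open>F\<close>. Its action on the ring
  is the comorphism \<open>p \<mapsto> p(F\<^sub>x, F\<^sub>y, F\<^sub>z, F\<^sub>u)\<close>, i.e. substitution.
\<close>

definition comorphism :: "(indet \<Rightarrow> poly4) \<Rightarrow> poly4 \<Rightarrow> poly4" where
  "comorphism F p =
     (\<Sum>m\<in>Poly_Mapping.keys p. const (Poly_Mapping.lookup p m) *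
        (\<Prod>i\<in>Poly_Mapping.keys m. F i ^ Poly_Mapping.lookup m i))"

definition x_automorphism :: "(indet \<Rightarrow> poly4) \<Rightarrow> bool" where
  "x_automorphism F \<longleftrightarrow> algebra_automorphism Cx (comorphism F)"

definition w_poly :: poly4 where
  "w_poly = pz ^ 2 + py * pu"

definition t_poly :: poly4 where
  "t_poly = px * pz + py * w_poly"

definition eta_poly :: poly4 where
  "eta_poly = px ^ 2 * pu - 2 * px * pz * w_poly - py * w_poly ^ 2"

definition venereau :: "nat \<Rightarrow> poly4" where
  "venereau n = py + px ^ n * (px * pz + py * (py * pu + pz ^ 2))"

text \<open>The natural-number exponents \<open>n - 3\<close> and \<open>n - 1\<close> below are intended for \<open>n \<ge> 3\<close>.\<close>

definition zeta :: "nat \<Rightarrow> poly4" where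
  "zeta n = - pz + px ^ (n - 3) * t_poly * (venereau n * eta_poly + px ^ 2 * w_poly)"

definition theta :: "nat \<Rightarrow> poly4" where
  "theta n = pu - px ^ (n - 3) * t_poly *
     (px * w_poly ^ 2 + eta_poly * (zeta n - pz + px ^ (n - 1) * t_poly * w_poly))"

primrec alpha :: "nat \<Rightarrow> indet \<Rightarrow> poly4" where
  "alpha n IX = px"
| "alpha n IY = venereau n"
| "alpha n IZ = zeta n"
| "alpha n IU = theta n"

end

theory Submission
  imports Defs
begin

text \<open>
  Over \<open>\<complex>[x,x\<^sup>-\<^sup>1]\<close> the elements \<open>y, t, \<eta>\<close> are coordinates, and \<open>x\<^sup>2 w = t\<^sup>2 + y \<eta>\<close>.
  For \<open>c \<in> \<complex>[x]\<close> the elementary automorphism \<open>y \<mapsto> y + c x\<^sup>3 t\<close> fixing \<open>t\<close> and \<open>\<eta>\<close> sends \<open>w\<close> to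
  \<open>w + c x t \<eta>\<close>, and solving for the images of \<open>z\<close> and \<open>u\<close> shows that it is already defined
  over \<open>\<complex>[x]\<close>. Its inverse is the one belonging to \<open>- c\<close>. Composing it, for \<open>c = x\<^bsup>n-3\<^esup>\<close>, with
  \<open>z \<mapsto> - z\<close> gives \<open>\<alpha>\<^sub>n\<close>.
\<close>

section \<open>Substitution homomorphisms\<close>

lemma UNIV_indet: "UNIV = {IX, IY, IZ, IU}"
proof (rule UNIV_eq_I)
  fix i show "i \<in> {IX, IY, IZ, IU}"
    by (cases i) simp_all
qed

text \<open>An indeterminate outside the support of \<open>m\<close> contributes
  \<open>F i ^ 0 = 1\<close>. With a fixed index set, adding exponent vectors needs no bookkeeping
  of supports.\<close>

lemma prod_keys_indet:
  fixes F :: "indet \<Rightarrow> 'a::comm_monoid_mult"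
  shows "(\<Prod>i\<in>Poly_Mapping.keys m. F i ^ Poly_Mapping.lookup m i) =
    (\<Prod>i\<in>UNIV. F i ^ Poly_Mapping.lookup m i)"
proof (rule prod.mono_neutral_left)
  show "finite (UNIV :: indet set)"
    by (simp add: UNIV_indet)
qed (auto simp: in_keys_iff)

lemma sum_single_lookup:
  "(\<Sum>m\<in>Poly_Mapping.keys p. Poly_Mapping.single m (Poly_Mapping.lookup p m)) = p"
  by (rule poly_mapping_eqI)
    (simp add: lookup_sum lookup_single when_def in_keys_iff)

lemma const_0 [simp]: "const 0 = 0"
  by (simp add: const_def)

lemma const_1 [simp]: "const 1 = 1"
  by (simp add: const_def)

lemma const_add: "const (a + b) = const a + const b"
  by (simp add: const_def single_add)

lemma const_mult: "const (a * b) = const a * const b"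
  by (simp add: const_def mult_single)

text \<open>Extra monomials have coefficient 0. A common index set for \<open>p\<close>,
  \<open>q\<close> and \<open>p + q\<close> then gives additivity.\<close>

lemma comorphism_superset:
  assumes "finite A" "Poly_Mapping.keys p \<subseteq> A"
  shows "comorphism F p =
    (\<Sum>m\<in>A. const (Poly_Mapping.lookup p m) * (\<Prod>i\<in>UNIV. F i ^ Poly_Mapping.lookup m i))"
  unfolding comorphism_def prod_keys_indet
  using assms by (intro sum.mono_neutral_left) (auto simp: in_keys_iff)

lemma comorphism_single:
  "comorphism F (Poly_Mapping.single m a) =
    const a * (\<Prod>i\<in>UNIV. F i ^ Poly_Mapping.lookup m i)"
  by (subst comorphism_superset[of "{m}"]) auto

lemma comorphism_add: "comorphism F (p + q) = comorphism F p + comorphism F q"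
proof -
  let ?A = "Poly_Mapping.keys p \<union> Poly_Mapping.keys q"
  have "Poly_Mapping.keys (p + q) \<subseteq> ?A"
    by (rule keys_add)
  then show ?thesis
    by (simp add: comorphism_superset[of ?A] lookup_add const_add distrib_right sum.distrib)
qed

lemma comorphism_0 [simp]: "comorphism F 0 = 0"
  by (simp add: comorphism_def)

lemma comorphism_const [simp]: "comorphism F (const a) = const a"
  using comorphism_single[of F 0 a] by (simp add: const_def)

lemma comorphism_1 [simp]: "comorphism F 1 = 1"
  using comorphism_const[of F 1] by simp

lemma comorphism_sum: "comorphism F (sum g A) = (\<Sum>a\<in>A. comorphism F (g a))"
  by (induction A rule: infinite_finite_induct) (simp_all add: comorphism_add)

lemma comorphism_mult: "comorphism F (p * q) = comorphism F p * comorphism F q"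
proof -
  \<comment> \<open>Both sides are biadditive, so monomials suffice: there exponents add and powers
    multiply.\<close>
  have single: "comorphism F (Poly_Mapping.single m a * Poly_Mapping.single k b) =
      comorphism F (Poly_Mapping.single m a) * comorphism F (Poly_Mapping.single k b)" for m k a b
    by (simp add: mult_single comorphism_single lookup_add power_add prod.distrib const_mult
        mult_ac)
  let ?S = "\<lambda>r. \<Sum>m\<in>Poly_Mapping.keys r. Poly_Mapping.single m (Poly_Mapping.lookup r m)"
  have "comorphism F (?S p * ?S q) = comorphism F (?S p) * comorphism F (?S q)"
    unfolding sum_product comorphism_sum single ..
  then show ?thesis
    unfolding sum_single_lookup .
qed

lemma comorphism_power: "comorphism F (p ^ k) = comorphism F p ^ k"
  by (induction k) (simp_all add: comorphism_mult)

lemma comorphism_prod: "comorphism F (prod g A) = (\<Prod>a\<in>A. comorphism F (g a))"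
  by (induction A rule: infinite_finite_induct) (simp_all add: comorphism_mult)

lemma comorphism_uminus: "comorphism F (- p) = - comorphism F p"
proof -
  have "comorphism F (- p) + comorphism F p = 0"
    by (simp flip: comorphism_add)
  then show ?thesis
    by (simp add: eq_neg_iff_add_eq_0)
qed

lemma comorphism_diff: "comorphism F (p - q) = comorphism F p - comorphism F q"
  using comorphism_add[of F p "- q"] by (simp add: comorphism_uminus)

lemma comorphism_2 [simp]: "comorphism F 2 = 2"
  using comorphism_add[of F 1 1] by simp

lemma comorphism_var [simp]: "comorphism F (var i) = F i"
  by (cases i) (simp_all add: var_def comorphism_single UNIV_indet lookup_single)

lemmas comorphism_simps = comorphism_add comorphism_mult comorphism_power comorphism_uminus
  comorphism_diff

text \<open>Reduces identities between composed substitutions to the four variables.\<close>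

lemma comorphism_comp:
  "comorphism F (comorphism G p) = comorphism (\<lambda>i. comorphism F (G i)) p"
  by (simp add: comorphism_def[of G] comorphism_def[of "\<lambda>i. comorphism F (G i)"]
      comorphism_sum comorphism_mult comorphism_prod comorphism_power)

lemma var_power: "var i ^ k = Poly_Mapping.single (Poly_Mapping.single i k) 1"
  by (induction k) (simp_all add: var_def mult_single flip: single_add)

lemma comorphism_var_id: "comorphism var p = p"
proof -
  have "(\<Prod>i\<in>UNIV. var i ^ Poly_Mapping.lookup m i) = Poly_Mapping.single m 1" for m
  proof -
    have m: "Poly_Mapping.single IX (Poly_Mapping.lookup m IX) +
        (Poly_Mapping.single IY (Poly_Mapping.lookup m IY) +
        (Poly_Mapping.single IZ (Poly_Mapping.lookup m IZ) +
         Poly_Mapping.single IU (Poly_Mapping.lookup m IU))) = m"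
    proof (rule poly_mapping_eqI)
      fix k
      show "Poly_Mapping.lookup (Poly_Mapping.single IX (Poly_Mapping.lookup m IX) +
        (Poly_Mapping.single IY (Poly_Mapping.lookup m IY) +
        (Poly_Mapping.single IZ (Poly_Mapping.lookup m IZ) +
         Poly_Mapping.single IU (Poly_Mapping.lookup m IU)))) k = Poly_Mapping.lookup m k"
        by (cases k) (simp_all add: lookup_add lookup_single)
    qed
    show ?thesis
      by (simp add: UNIV_indet var_power mult_single m)
  qed
  then have "comorphism var (Poly_Mapping.single m a) = Poly_Mapping.single m a" for m a
    by (simp add: comorphism_single const_def mult_single)
  then show ?thesis
    by (metis (no_types, lifting) comorphism_sum sum.cong sum_single_lookup)
qed

lemma comorphism_Cx:
  assumes "F IX = px" "p \<in> Cx"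
  shows "comorphism F p = p"
proof -
  have "comorphism F p = comorphism var p"
    unfolding comorphism_def
  proof (intro sum.cong prod.cong arg_cong2[of _ _ _ _ "(*)"] refl)
    fix m i
    assume "m \<in> Poly_Mapping.keys p" "i \<in> Poly_Mapping.keys m"
    then have "i = IX"
      using assms(2) by (auto simp: Cx_def)
    then show "F i ^ Poly_Mapping.lookup m i = var i ^ Poly_Mapping.lookup m i"
      using assms(1) by simp
  qed
  then show ?thesis
    by (simp add: comorphism_var_id)
qed

lemma const_in_Cx: "const a \<in> Cx"
  by (auto simp: Cx_def const_def split: if_splits)

lemma px_in_Cx: "px \<in> Cx"
  by (auto simp: Cx_def var_def)

lemma x_automorphismI:
  assumes "F IX = px"
    and "\<And>p. comorphism G (comorphism F p) = p" "\<And>p. comorphism F (comorphism G p) = p"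
  shows "x_automorphism F"
proof -
  have "bij (comorphism F)"
    using assms(2,3) by (intro bijI') metis+
  then show ?thesis
    using assms(1) comorphism_Cx
    by (simp add: x_automorphism_def algebra_automorphism_def comorphism_add comorphism_mult)
qed

section \<open>Generated subrings and x-variables\<close>

lemma subring_gen_sum:
  assumes "\<And>a. a \<in> A \<Longrightarrow> g a \<in> subring_gen S"
  shows "sum g A \<in> subring_gen S"
proof -
  have zero: "0 \<in> subring_gen S"
    using subring_gen.diff[OF subring_gen.one subring_gen.one] by simp
  have add: "a + b \<in> subring_gen S" if "a \<in> subring_gen S" "b \<in> subring_gen S" for a b
    using subring_gen.diff[OF that(1) subring_gen.diff[OF zero that(2)]] by simp
  show ?thesis
    using assms by (induction A rule: infinite_finite_induct) (auto intro: zero add)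
qed

lemma subring_gen_power: "a \<in> subring_gen S \<Longrightarrow> a ^ k \<in> subring_gen S"
  by (induction k) (auto intro: subring_gen.intros)

lemma subring_gen_prod:
  assumes "\<And>a. a \<in> A \<Longrightarrow> g a \<in> subring_gen S"
  shows "prod g A \<in> subring_gen S"
  using assms by (induction A rule: infinite_finite_induct) (auto intro: subring_gen.intros)

text \<open>By surjectivity every polynomial is some \<open>comorphism F q\<close>, hence a
  polynomial expression over the complex numbers in the \<open>F i\<close>, of which
  \<open>F IX = px\<close> lies in \<open>Cx\<close>.\<close>

lemma x_variable_if_x_automorphism:
  assumes "x_automorphism F" "F IX = px"
  shows "x_variable (F IY)"
proof -
  let ?S = "Cx \<union> {F IY, F IZ, F IU}"
  have F: "F i \<in> subring_gen ?S" for i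
    using assms(2) px_in_Cx by (cases i) (auto intro: subring_gen.incl)
  have "comorphism F q \<in> subring_gen ?S" for q
    unfolding comorphism_def
    using const_in_Cx F
    by (intro subring_gen_sum subring_gen.mult subring_gen_prod subring_gen_power)
      (auto intro: subring_gen.incl)
  moreover have "surj (comorphism F)"
    using assms(1) by (simp add: x_automorphism_def algebra_automorphism_def bij_is_surj)
  ultimately have "subring_gen ?S = UNIV"
    by (metis UNIV_eq_I surjD)
  then show ?thesis
    unfolding x_variable_def by blast
qed

section \<open>The automorphisms fixing \<open>t\<close> and \<open>\<eta>\<close>\<close>

text \<open>\<open>W\<close> comes from solving \<open>x ^ 2 * W = t ^ 2 + v * e\<close>. As
  \<open>x\<close> need not be cancellable here, the identities are checked by expansion, with
  \<open>t\<close>, \<open>w\<close>, \<open>e\<close> kept as symbols.\<close>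

lemma twist_identities:
  fixes x y z u c :: "'a::comm_ring_1"
  assumes w: "w = z ^ 2 + y * u" and t: "t = x * z + y * w"
    and e: "e = x ^ 2 * u - 2 * x * z * w - y * w ^ 2"
    and v: "v = y + c * x ^ 3 * t" and Z: "Z = z - c * t * (v * e + x ^ 2 * w)"
    and U: "U = u - c * t * (x * w ^ 2 + e * (c * x ^ 2 * t * w - Z - z))"
    and W: "W = w + c * x * t * e"
  shows "Z ^ 2 + v * U = W"
    and "x * Z + v * W = t"
    and "x ^ 2 * U - 2 * x * Z * W - v * W ^ 2 = e"
proof -
  \<comment> \<open>A formal identity; the two corrections vanish by the definitions of
    \<open>w\<close> and \<open>e\<close>.\<close>
  have "Z ^ 2 + v * U = w + c * x * t * e + (z ^ 2 + y * u - w) +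
      c * t * x * (x ^ 2 * u - 2 * x * z * w - y * w ^ 2 - e)"
    unfolding U Z v by (simp add: algebra_simps eval_nat_numeral)
  then show "Z ^ 2 + v * U = W"
    using w e W by simp
  have "x * Z + v * W = x * z + y * w"
    unfolding Z v W by (simp add: algebra_simps eval_nat_numeral)
  then show xZ': "x * Z + v * W = t"
    using t by simp
  have xz: "x * z = t - y * w" and xZ: "x * Z = t - v * W"
    using t xZ' by (simp_all add: algebra_simps)
  \<comment> \<open>After multiplication by \<open>x ^ 2\<close>, the letters \<open>z\<close>,
    \<open>Z\<close>, \<open>u\<close> occur only in \<open>x * z\<close>, \<open>x * Z\<close>,
    \<open>x ^ 2 * u\<close>, which can be eliminated.\<close>
  have "x ^ 2 * U = x ^ 2 * u -
      c * t * (x ^ 3 * w ^ 2 + e * (c * x ^ 4 * t * w - x * (x * Z) - x * (x * z)))"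
    unfolding U by (simp add: algebra_simps eval_nat_numeral)
  moreover have "x ^ 2 * u = e + 2 * (x * z) * w + y * w ^ 2"
    using e by (simp add: algebra_simps)
  ultimately have "x ^ 2 * U - 2 * (x * Z) * W - v * W ^ 2 =
      e + 2 * (t - y * w) * w + y * w ^ 2 -
      c * t * (x ^ 3 * w ^ 2 + e * (c * x ^ 4 * t * w - x * (t - v * W) - x * (t - y * w))) -
      2 * (t - v * W) * W - v * W ^ 2"
    unfolding xz xZ by simp
  also have "\<dots> = e"
    unfolding W v by (simp add: algebra_simps eval_nat_numeral)
  finally show "x ^ 2 * U - 2 * x * Z * W - v * W ^ 2 = e"
    by (simp add: mult.assoc)
qed

text \<open>Two of the three factors \<open>px\<close> allow the division by \<open>x ^ 2\<close>
  that gives \<open>W\<close>, the third the division of \<open>t - v * W\<close> by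
  \<open>x\<close> that gives \<open>twist_z\<close>.\<close>

definition twist_y :: "poly4 \<Rightarrow> poly4" where
  "twist_y c = py + c * px ^ 3 * t_poly"

definition twist_z :: "poly4 \<Rightarrow> poly4" where
  "twist_z c = pz - c * t_poly * (twist_y c * eta_poly + px ^ 2 * w_poly)"

text \<open>The solution \<open>U\<close> of
  \<open>x ^ 2 * U = e + 2 * x * Z * W + v * W ^ 2\<close>, in the notation of
  \<open>twist_identities\<close>.\<close>

definition twist_u :: "poly4 \<Rightarrow> poly4" where
  "twist_u c = pu - c * t_poly *
     (px * w_poly ^ 2 + eta_poly * (c * px ^ 2 * t_poly * w_poly - twist_z c - pz))"

primrec twist :: "poly4 \<Rightarrow> indet \<Rightarrow> poly4" where
  "twist c IX = px"
| "twist c IY = twist_y c"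
| "twist c IZ = twist_z c"
| "twist c IU = twist_u c"

lemma
  shows comorphism_twist_w: "comorphism (twist c) w_poly = w_poly + c * px * t_poly * eta_poly"
    and comorphism_twist_t: "comorphism (twist c) t_poly = t_poly"
    and comorphism_twist_eta: "comorphism (twist c) eta_poly = eta_poly"
proof -
  note ids = twist_identities[OF w_poly_def t_poly_def eta_poly_def twist_y_def twist_z_def
      twist_u_def refl, of c]
  \<comment> \<open>This image comes first because \<open>t_poly\<close> and \<open>eta_poly\<close>
    are expressed through \<open>w_poly\<close>.\<close>
  show w: "comorphism (twist c) w_poly = w_poly + c * px * t_poly * eta_poly"
    unfolding ids(1)[symmetric] by (simp add: w_poly_def comorphism_simps)
  show "comorphism (twist c) t_poly = t_poly"
    using ids(2) by (simp add: t_poly_def comorphism_simps w)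
  show "comorphism (twist c) eta_poly = eta_poly"
    using ids(3) by (simp add: eta_poly_def comorphism_simps w)
qed

text \<open>Since \<open>twist c\<close> fixes \<open>c\<close>, \<open>t_poly\<close> and
  \<open>eta_poly\<close>, it turns \<open>py - c * px ^ 3 * t_poly\<close> back into
  \<open>py\<close>; this yields \<open>pz\<close>, which in turn yields \<open>pu\<close>.\<close>

lemma comorphism_twist_minus:
  assumes "c \<in> Cx"
  shows "comorphism (twist c) (comorphism (twist (- c)) p) = p"
proof -
  have c: "comorphism (twist c) c = c"
    using assms by (simp add: comorphism_Cx)
  note simps = comorphism_simps c comorphism_twist_w comorphism_twist_t comorphism_twist_eta
  have y: "comorphism (twist c) (twist_y (- c)) = py"
    by (simp add: twist_y_def[of "- c"] simps) (simp add: twist_y_def)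
  have z: "comorphism (twist c) (twist_z (- c)) = pz"
    by (simp add: twist_z_def[of "- c"] simps y)
      (simp add: twist_z_def twist_y_def algebra_simps eval_nat_numeral)
  have u: "comorphism (twist c) (twist_u (- c)) = pu"
    by (simp add: twist_u_def[of "- c"] simps z)
      (simp add: twist_u_def algebra_simps eval_nat_numeral)
  have "comorphism (twist c) (twist (- c) i) = var i" for i
    by (cases i) (simp_all add: y z u)
  then show ?thesis
    by (simp add: comorphism_comp comorphism_var_id)
qed

section \<open>Factoring \<open>alpha n\<close> through the sign change of \<open>z\<close>\<close>

definition flip_z :: "indet \<Rightarrow> poly4" where
  "flip_z = var(IZ := - pz)"

lemma comorphism_flip_z_flip_z: "comorphism flip_z (comorphism flip_z p) = p"
proof -
  have "comorphism flip_z (flip_z i) = var i" for i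
    by (simp add: flip_z_def comorphism_uminus)
  then show ?thesis
    by (simp add: comorphism_comp comorphism_var_id)
qed

lemma comorphism_alpha:
  assumes "n \<ge> 3"
  shows "comorphism (alpha n) p = comorphism (twist (px ^ (n - 3))) (comorphism flip_z p)"
proof -
  \<comment> \<open>Removes truncated subtraction: \<open>n - 3\<close> is \<open>k\<close>, and
    \<open>n - 1\<close> is \<open>k + 2\<close>, matching \<open>c * px ^ 2\<close> in
    \<open>twist_u\<close>.\<close>
  obtain k where n: "n = k + 3"
    using assms by (metis add.commute le_Suc_ex)
  have y: "twist_y (px ^ k) = venereau n"
    by (simp add: twist_y_def venereau_def t_poly_def w_poly_def n power_add add.commute)
  have z: "twist_z (px ^ k) = - zeta n"
    by (simp add: twist_z_def zeta_def y n)
  have u: "twist_u (px ^ k) = theta n"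
    by (simp add: twist_u_def theta_def z n power_add algebra_simps eval_nat_numeral)
  have "alpha n i = comorphism (twist (px ^ k)) (flip_z i)" for i
    by (cases i) (simp_all add: flip_z_def comorphism_uminus y z u)
  then have "alpha n = (\<lambda>i. comorphism (twist (px ^ k)) (flip_z i))"
    by blast
  then show ?thesis
    by (simp add: comorphism_comp n)
qed

theorem corollary1:
  fixes n :: nat
  assumes "n \<ge> 3"
  shows "x_variable (venereau n) \<and> x_automorphism (alpha n)"
proof -
  let ?c = "px ^ (n - 3)"
  \<comment> \<open>The inverse undoes the twist first and the involution \<open>flip_z\<close>
    last.\<close>
  let ?G = "\<lambda>i. comorphism flip_z (twist (- ?c) i)"
  have c: "?c \<in> Cx" "- ?c \<in> Cx"
    by (auto simp: Cx_def var_power split: if_splits)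
  have G: "comorphism ?G p = comorphism flip_z (comorphism (twist (- ?c)) p)" for p
    by (simp add: comorphism_comp)
  have "x_automorphism (alpha n)"
    \<comment> \<open>The two signs supply the two orders of composition.\<close>
    using comorphism_twist_minus[OF c(1)] comorphism_twist_minus[OF c(2)]
    by (intro x_automorphismI[where G = ?G])
      (simp_all add: G comorphism_alpha[OF assms] comorphism_flip_z_flip_z)
  then show ?thesis
    using x_variable_if_x_automorphism[of "alpha n"] by simp
qed

end
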